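(* Let $R$ be a commutative semiring and let $S\subseteq R$ be a multiplicatively closed set. If $I$ is a quasi $S$-$n$-ideal of $R$ and $\sqrt{I}=N(R)$, then $\sqrt{I}$ is an $S$-prime ideal of $R$.
   Context: All semirings are commutative with identity $1\neq 0$. A subset $S$ of $R$ is multiplicatively closed if $0\notin S$, $1\in S$, and $st\in S$ for all $s,t\in S$. For an ideal $I$, $\sqrt{I}=\{a\in R: a^n\in I \text{ for some } n\in\mathbb{N}\}$, and $N(R)=\sqrt{(0)}$ is the nilradical. A proper ideal $I$ of $R$ with $I\cap S=\emptyset$ is a quasi $S$-$n$-ideal of $R$ if there exists a fixed element $s\in S$ such that, for all $a,b\in R$, $ab\in I$ implies $sa^2\in I$ or $sb\in N(R)$. An ideal $P$ of $R$ with $P\cap S=\emptyset$ is $S$-prime if there exists $s\in S$ such that, for all $a,b\in R$, $ab\in P$ implies $sa\in P$ or $sb\in P$. *)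

theory Defs
  imports Main
begin

text \<open>
  The ambient semiring is a type of class \<^class>\<open>comm_semiring_1\<close>: addition and multiplication are
  commutative, \<open>0\<close> is absorbing, and \<open>0 \<noteq> 1\<close>. The set \<open>UNIV\<close> plays the role of \<open>R\<close>.
\<close>

definition semiring_ideal :: "'a::comm_semiring_1 set \<Rightarrow> bool" where
  "semiring_ideal I \<longleftrightarrow>
     I \<noteq> {} \<and> (\<forall>a\<in>I. \<forall>b\<in>I. a + b \<in> I) \<and> (\<forall>r. \<forall>a\<in>I. r * a \<in> I)"

definition mult_closed :: "'a::comm_semiring_1 set \<Rightarrow> bool" where
  "mult_closed S \<longleftrightarrow> 0 \<notin> S \<and> 1 \<in> S \<and> (\<forall>s\<in>S. \<forall>t\<in>S. s * t \<in> S)"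

text \<open>
  The exponent ranges over the positive integers.
  (For a proper ideal, allowing \<open>n = 0\<close> would change nothing, as \<open>a ^ 0 = 1\<close>.)
\<close>

definition ideal_radical :: "'a::comm_semiring_1 set \<Rightarrow> 'a set" where
  "ideal_radical I = {a. \<exists>n::nat. 0 < n \<and> a ^ n \<in> I}"

definition nilradical :: "'a::comm_semiring_1 set" where
  "nilradical = ideal_radical {0}"

definition quasi_S_n_ideal :: "'a::comm_semiring_1 set \<Rightarrow> 'a set \<Rightarrow> bool" where
  "quasi_S_n_ideal S I \<longleftrightarrow>
     semiring_ideal I \<and> I \<noteq> UNIV \<and> I \<inter> S = {} \<and>
     (\<exists>s\<in>S. \<forall>a b. a * b \<in> I \<longrightarrow> s * a ^ 2 \<in> I \<or> s * b \<in> nilradical)"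

definition S_prime_ideal :: "'a::comm_semiring_1 set \<Rightarrow> 'a set \<Rightarrow> bool" where
  "S_prime_ideal S P \<longleftrightarrow>
     semiring_ideal P \<and> P \<inter> S = {} \<and>
     (\<exists>s\<in>S. \<forall>a b. a * b \<in> P \<longrightarrow> s * a \<in> P \<or> s * b \<in> P)"

end

theory Submission
  imports Defs
begin

text \<open>
  If \<open>a * b\<close> lies in the radical of \<open>I\<close>, then \<open>a ^ n * b ^ n \<in> I\<close> for some \<open>n > 0\<close>. With \<open>s\<close> the
  element witnessing that \<open>I\<close> is a quasi \<open>S\<close>-\<open>n\<close>-ideal, either \<open>s * a ^ (2 * n) \<in> I\<close> or \<open>s * b ^ n\<close> is
  nilpotent. Multiplying by powers of \<open>s\<close> turns these elements into powers of \<open>s * a\<close> and \<open>s * b\<close>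
  (lemma \<open>power_mult_mem_ideal\<close>). Hence \<open>s * a\<close> lies in the radical of \<open>I\<close>, or \<open>s * b\<close> lies in the
  nilradical; the two sets coincide by hypothesis. So the radical is \<open>S\<close>-prime with the same
  element \<open>s\<close>. That it is an ideal is proved with the binomial theorem, which needs no subtraction.
\<close>

lemma semiring_ideal_mult: "semiring_ideal I \<Longrightarrow> a \<in> I \<Longrightarrow> r * a \<in> I"
  by (simp add: semiring_ideal_def)

lemma semiring_ideal_sum:
  assumes I: "semiring_ideal I" and mem: "\<And>x. x \<in> A \<Longrightarrow> f x \<in> I"
  shows "sum f A \<in> I"
proof -
  obtain c where "c \<in> I" using I by (auto simp: semiring_ideal_def)
  then have zero: "0 \<in> I" using semiring_ideal_mult[OF I, of c 0] by simp
  show ?thesis using mem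
  proof (induction A rule: infinite_finite_induct)
    case (insert x F)
    then show ?case using I by (simp add: semiring_ideal_def)
  qed (simp_all add: zero)
qed

lemma ideal_radicalI: "0 < n \<Longrightarrow> a ^ n \<in> I \<Longrightarrow> a \<in> ideal_radical I"
  by (auto simp: ideal_radical_def)

lemma ideal_radicalE:
  assumes "a \<in> ideal_radical I"
  obtains n :: nat where "0 < n" "a ^ n \<in> I"
  using assms by (auto simp: ideal_radical_def)

lemma power_mem_ideal_radicalD:
  assumes "0 < n" and "a ^ n \<in> ideal_radical I"
  shows "a \<in> ideal_radical I"
proof -
  obtain m where "0 < m" "(a ^ n) ^ m \<in> I" using assms(2) by (rule ideal_radicalE)
  then show ?thesis
    using assms(1) by (intro ideal_radicalI[of "n * m"]) (simp_all add: power_mult)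
qed

lemma power_mem_ideal_mono:
  assumes I: "semiring_ideal I" and "a ^ m \<in> I" and "m \<le> n"
  shows "a ^ n \<in> I"
proof -
  have "a ^ n = a ^ (n - m) * a ^ m" using \<open>m \<le> n\<close> by (simp flip: power_add)
  then show ?thesis using semiring_ideal_mult[OF I \<open>a ^ m \<in> I\<close>] by simp
qed

text \<open>
  If \<open>a ^ m\<close> and \<open>b ^ n\<close> lie in \<open>I\<close>, then each term \<open>a ^ k * b ^ (m + n - k)\<close> in the binomial expansion
  of \<open>(a + b) ^ (m + n)\<close> has \<open>k \<ge> m\<close> or \<open>m + n - k \<ge> n\<close>, and is therefore in \<open>I\<close>.
\<close>

lemma semiring_ideal_ideal_radical:
  assumes I: "semiring_ideal I"
  shows "semiring_ideal (ideal_radical I)"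
proof -
  have "ideal_radical I \<noteq> {}"
    using I ideal_radicalI[of 1 _ I] by (auto simp: semiring_ideal_def)
  moreover have "a + b \<in> ideal_radical I"
    if a: "a \<in> ideal_radical I" and b: "b \<in> ideal_radical I" for a b
  proof -
    obtain m where m: "0 < m" "a ^ m \<in> I" using a by (rule ideal_radicalE)
    obtain n where n: "0 < n" "b ^ n \<in> I" using b by (rule ideal_radicalE)
    have "of_nat (m + n choose k) * a ^ k * b ^ (m + n - k) \<in> I" for k
    proof (cases "m \<le> k")
      case True
      then have "of_nat (m + n choose k) * b ^ (m + n - k) * a ^ k \<in> I"
        by (intro semiring_ideal_mult[OF I] power_mem_ideal_mono[OF I m(2)])
      then show ?thesis by (simp add: ac_simps)
    next
      case False
      then have "n \<le> m + n - k" by simp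
      then show ?thesis
        by (intro semiring_ideal_mult[OF I] power_mem_ideal_mono[OF I n(2)])
    qed
    then have "(a + b) ^ (m + n) \<in> I"
      unfolding binomial_ring by (intro semiring_ideal_sum[OF I])
    then show ?thesis using m(1) by (intro ideal_radicalI[of "m + n"]) simp_all
  qed
  moreover have "r * a \<in> ideal_radical I" if a: "a \<in> ideal_radical I" for r a
  proof -
    obtain n where "0 < n" "a ^ n \<in> I" using a by (rule ideal_radicalE)
    then show ?thesis
      using semiring_ideal_mult[OF I]
      by (intro ideal_radicalI[of n]) (simp_all add: power_mult_distrib)
  qed
  ultimately show ?thesis by (simp add: semiring_ideal_def)
qed

lemma mult_closed_power:
  assumes "mult_closed S" and "s \<in> S"
  shows "s ^ n \<in> S"
  using assms by (induction n) (auto simp: mult_closed_def)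

lemma ideal_radical_disjoint:
  assumes "mult_closed S" and "I \<inter> S = {}"
  shows "ideal_radical I \<inter> S = {}"
  using assms mult_closed_power by (fastforce elim: ideal_radicalE)

lemma power_mult_mem_ideal:
  assumes I: "semiring_ideal I" and "s * a ^ n \<in> I" and "0 < n"
  shows "(s * a) ^ n \<in> I"
proof -
  have "(s * a) ^ n = s ^ (n - 1) * (s * a ^ n)"
    using \<open>0 < n\<close> by (cases n) (simp_all add: power_mult_distrib ac_simps)
  then show ?thesis using semiring_ideal_mult[OF I \<open>s * a ^ n \<in> I\<close>] by simp
qed

theorem theorem2p9:
  fixes S I :: "'a::comm_semiring_1 set"
  assumes "mult_closed S"
    and "quasi_S_n_ideal S I"
    and "ideal_radical I = nilradical"
  shows "S_prime_ideal S (ideal_radical I)"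
proof -
  let ?P = "ideal_radical I"
  have I: "semiring_ideal I" and disj: "I \<inter> S = {}"
    using assms(2) by (simp_all add: quasi_S_n_ideal_def)
  obtain s where "s \<in> S"
    and s: "\<And>a b. a * b \<in> I \<Longrightarrow> s * a ^ 2 \<in> I \<or> s * b \<in> ?P"
    using assms(2,3) by (auto simp: quasi_S_n_ideal_def)
  have P: "semiring_ideal ?P" by (rule semiring_ideal_ideal_radical[OF I])
  have "s * a \<in> ?P \<or> s * b \<in> ?P" if ab: "a * b \<in> ?P" for a b
  proof -
    obtain n where n: "0 < n" "(a * b) ^ n \<in> I" using ab by (rule ideal_radicalE)
    then have "s * (a ^ n) ^ 2 \<in> I \<or> s * b ^ n \<in> ?P"
      by (intro s) (simp add: power_mult_distrib)
    then show ?thesis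
    proof
      assume "s * (a ^ n) ^ 2 \<in> I"
      then have "s * a ^ (n * 2) \<in> I" by (simp only: power_mult)
      then have "(s * a) ^ (n * 2) \<in> I"
        by (rule power_mult_mem_ideal[OF I]) (simp add: n(1))
      then have "s * a \<in> ?P" using n(1) by (intro ideal_radicalI[of "n * 2"]) simp_all
      then show ?thesis ..
    next
      assume "s * b ^ n \<in> ?P"
      then have "(s * b) ^ n \<in> ?P" using n(1) by (rule power_mult_mem_ideal[OF P])
      then have "s * b \<in> ?P" by (rule power_mem_ideal_radicalD[OF n(1)])
      then show ?thesis ..
    qed
  qed
  then show ?thesis
    using P ideal_radical_disjoint[OF assms(1) disj] \<open>s \<in> S\<close>
    by (auto simp: S_prime_ideal_def)
qed

end
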